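(* Let $\boldsymbol{x}=\{x_1,\dots,x_n\}$ and $\boldsymbol{X}=\{X_1,\dots,X_n\}$. The Magnus maps $$\mathcal M\colon \mathcal F(\boldsymbol{x})\to\overline{\mathbb{Q}\{\boldsymbol{X}\}}^{\times},\quad x_i\mapsto 1+X_i,$$ and $$\mathcal M_c\colon \mathcal F_c(\boldsymbol{x})\to\overline{\mathbb{Q}_c\{\boldsymbol{X}\}}^{\times},\quad x_i\mapsto 1+X_i,$$ are injective.
   Context: $\mathcal F(\boldsymbol{x})$ denotes the free loop on $\boldsymbol{x}$ and $\mathcal F_c(\boldsymbol{x})$ the free commutative loop on $\boldsymbol{x}$ (a loop being a set with a product and two-sided identity in which all left and right multiplications are bijective). $\mathbb{Q}\{\boldsymbol{X}\}$ is the free non-associative (non-commutative) algebra over $\mathbb{Q}$ on $\boldsymbol{X}$, and $\mathbb{Q}_c\{\boldsymbol{X}\}$ the free commutative non-associative algebra over $\mathbb{Q}$ on $\boldsymbol{X}$; the overline denotes completion with respect to degree, i.e. the algebra of non-associative formal power series. The elements of such a completion with non-zero constant term form a loop under multiplication, denoted by the superscript $\times$. $\mathcal M$ and $\mathcal M_c$ are the unique loop homomorphisms determined by the given values on generators. *)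

theory Defs
  imports Complex_Main
begin

text \<open>Loop terms over generators x_i (i :: nat); loops are treated as the variety
with product, identity, left division and right division.\<close>

datatype ltm = Gen nat | One | Mul ltm ltm | LDiv ltm ltm | RDiv ltm ltm

primrec gens :: "ltm \<Rightarrow> nat set" where
  "gens (Gen i) = {i}"
| "gens One = {}"
| "gens (Mul s t) = gens s \<union> gens t"
| "gens (LDiv s t) = gens s \<union> gens t"
| "gens (RDiv s t) = gens s \<union> gens t"

inductive loop_eq :: "bool \<Rightarrow> ltm \<Rightarrow> ltm \<Rightarrow> bool" for c :: bool where
  refl: "loop_eq c s s"
| sym: "loop_eq c s t \<Longrightarrow> loop_eq c t s"
| trans: "loop_eq c s t \<Longrightarrow> loop_eq c t u \<Longrightarrow> loop_eq c s u"
| cong_mul: "loop_eq c s s' \<Longrightarrow> loop_eq c t t' \<Longrightarrow> loop_eq c (Mul s t) (Mul s' t')"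
| cong_ldiv: "loop_eq c s s' \<Longrightarrow> loop_eq c t t' \<Longrightarrow> loop_eq c (LDiv s t) (LDiv s' t')"
| cong_rdiv: "loop_eq c s s' \<Longrightarrow> loop_eq c t t' \<Longrightarrow> loop_eq c (RDiv s t) (RDiv s' t')"
| one_left: "loop_eq c (Mul One s) s"
| one_right: "loop_eq c (Mul s One) s"
| ldiv_mul: "loop_eq c (LDiv s (Mul s t)) t"
| mul_ldiv: "loop_eq c (Mul s (LDiv s t)) t"
| rdiv_mul: "loop_eq c (RDiv (Mul t s) s) t"
| mul_rdiv: "loop_eq c (Mul (RDiv t s) s) t"
| comm: "c \<Longrightarrow> loop_eq c (Mul s t) (Mul t s)"

abbreviation free_loop_eq :: "ltm \<Rightarrow> ltm \<Rightarrow> bool" where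
  "free_loop_eq \<equiv> loop_eq False"

abbreviation free_comm_loop_eq :: "ltm \<Rightarrow> ltm \<Rightarrow> bool" where
  "free_comm_loop_eq \<equiv> loop_eq True"

text \<open>Non-associative (non-empty) monomials in the X_i are binary trees; a monomial
of the unital algebra is either the empty monomial U or a tree.\<close>

datatype tree = Leaf nat | Node tree tree
datatype mon = U | T tree

type_synonym series = "mon \<Rightarrow> rat"

fun nmul :: "series \<Rightarrow> series \<Rightarrow> series" where
  "nmul f g U = f U * g U"
| "nmul f g (T (Leaf i)) = f U * g (T (Leaf i)) + f (T (Leaf i)) * g U"
| "nmul f g (T (Node a b)) =
     f U * g (T (Node a b)) + f (T (Node a b)) * g U + f (T a) * g (T b)"

definition sone :: series where
  "sone w = (if w = U then 1 else 0)"

definition svar :: "nat \<Rightarrow> series" where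
  "svar i w = (if w = T (Leaf i) then 1 else 0)"

definition splus :: "series \<Rightarrow> series \<Rightarrow> series" where
  "splus f g w = f w + g w"

text \<open>Divisions in the loop of series with nonzero constant term.\<close>

definition nldiv :: "series \<Rightarrow> series \<Rightarrow> series" where
  "nldiv a b = (THE c. nmul a c = b)"

definition nrdiv :: "series \<Rightarrow> series \<Rightarrow> series" where
  "nrdiv b a = (THE c. nmul c a = b)"

text \<open>Commutative non-associative monomials: trees modulo swapping children.\<close>

fun ceq :: "tree \<Rightarrow> tree \<Rightarrow> bool" where
  "ceq (Leaf i) (Leaf j) = (i = j)"
| "ceq (Node a b) (Node c d) = ((ceq a c \<and> ceq b d) \<or> (ceq a d \<and> ceq b c))"
| "ceq _ _ = False"

fun ceqm :: "mon \<Rightarrow> mon \<Rightarrow> bool" where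
  "ceqm U U = True"
| "ceqm (T a) (T b) = ceq a b"
| "ceqm _ _ = False"

text \<open>Series in the completion of Q_c{X}: coefficient functions on classes of
commutative monomials, represented as functions constant on classes.\<close>

definition cseries :: "series set" where
  "cseries = {f. \<forall>v w. ceqm v w \<longrightarrow> f v = f w}"

text \<open>Product in the completion of Q_c{X}: the coefficient of the class of Node a b
collects the products over the (one or two) ordered pairs of classes ([a],[b]), ([b],[a]).\<close>

fun cmul :: "series \<Rightarrow> series \<Rightarrow> series" where
  "cmul f g U = f U * g U"
| "cmul f g (T (Leaf i)) = f U * g (T (Leaf i)) + f (T (Leaf i)) * g U"
| "cmul f g (T (Node a b)) =
     f U * g (T (Node a b)) + f (T (Node a b)) * g U
     + (if ceq a b then f (T a) * g (T b) else f (T a) * g (T b) + f (T b) * g (T a))"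

definition cldiv :: "series \<Rightarrow> series \<Rightarrow> series" where
  "cldiv a b = (THE c. c \<in> cseries \<and> cmul a c = b)"

definition crdiv :: "series \<Rightarrow> series \<Rightarrow> series" where
  "crdiv b a = (THE c. c \<in> cseries \<and> cmul c a = b)"

primrec magnus :: "ltm \<Rightarrow> series" where
  "magnus (Gen i) = splus sone (svar i)"
| "magnus One = sone"
| "magnus (Mul s t) = nmul (magnus s) (magnus t)"
| "magnus (LDiv s t) = nldiv (magnus s) (magnus t)"
| "magnus (RDiv s t) = nrdiv (magnus s) (magnus t)"

primrec magnus_c :: "ltm \<Rightarrow> series" where
  "magnus_c (Gen i) = splus sone (svar i)"
| "magnus_c One = sone"
| "magnus_c (Mul s t) = cmul (magnus_c s) (magnus_c t)"
| "magnus_c (LDiv s t) = cldiv (magnus_c s) (magnus_c t)"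
| "magnus_c (RDiv s t) = crdiv (magnus_c s) (magnus_c t)"

end

theory Submission
  imports Defs
begin

text \<open>Write \<open>M\<close> for either Magnus map and \<open>u' = M(u) - 1\<close>. The images of pairwise distinct
  elements of the free loop are in fact linearly independent; this is shown for finite families
  \<open>S\<close> containing, with each element, the subterms from which it is built, by adjoining one
  element at a time. The decomposable part of every \<open>M(z)\<close>, \<open>z \<in> S\<close>, lies in the span of the
  tensors \<open>u' \<otimes> v'\<close> (symmetrised in the commutative case) with \<open>u, v, uv \<in> S\<close>, and by
  independence these tensors are independent as well.

  If a product \<open>st\<close> is adjoined and \<open>M(st)\<close> depended on \<open>S\<close>, then \<open>s' \<otimes> t'\<close> would lie in that
  span, although \<open>st \<notin> S\<close>. If a quotient \<open>w\<close> with \<open>sw = t\<close> is adjoined and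
  \<open>M(w) = \<Sum> d\<^sub>v M(v)\<close>, then \<open>s' \<otimes> w' = \<Sum> d\<^sub>v (s' \<otimes> v')\<close> lies in that span, so \<open>sv \<in> S\<close> whenever
  \<open>d\<^sub>v \<noteq> 0\<close>; multiplying by \<open>M(s)\<close> gives \<open>M(t) = \<Sum> d\<^sub>v M(sv)\<close>, a nontrivial relation inside \<open>S\<close>
  because \<open>t = sw\<close> is none of the \<open>sv\<close>.\<close>

section \<open>Products and quotients of series\<close>

text \<open>The weights \<open>p\<close> and \<open>q\<close> make multiplication by a fixed
  \<open>f\<close>, from either side and in both algebras, an instance of one linear operator, so
  that solving and cancelling are done once.\<close>

fun gmul :: "(tree \<Rightarrow> tree \<Rightarrow> rat) \<Rightarrow> (tree \<Rightarrow> tree \<Rightarrow> rat) \<Rightarrow> series \<Rightarrow> series \<Rightarrow> series" where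
  "gmul p q f g U = f U * g U"
| "gmul p q f g (T (Leaf i)) = f U * g (T (Leaf i)) + f (T (Leaf i)) * g U"
| "gmul p q f g (T (Node a b)) =
     f U * g (T (Node a b)) + f (T (Node a b)) * g U
     + (p a b * f (T a) * g (T b) + q a b * f (T b) * g (T a))"

text \<open>The tree coefficients of the solution \<open>g\<close> of
  \<open>gmul p q f g = h\<close>: the constant term is \<open>h U / f U\<close>, and every further
  coefficient is forced by those at the subtrees as soon as \<open>f U\<close> is
  invertible.\<close>

primrec gquot :: "(tree \<Rightarrow> tree \<Rightarrow> rat) \<Rightarrow> (tree \<Rightarrow> tree \<Rightarrow> rat) \<Rightarrow> series \<Rightarrow> series \<Rightarrow> tree \<Rightarrow> rat" where
  "gquot p q f h (Leaf i) = (h (T (Leaf i)) - f (T (Leaf i)) * (h U / f U)) / f U"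
| "gquot p q f h (Node a b) =
     (h (T (Node a b)) - f (T (Node a b)) * (h U / f U)
      - (p a b * f (T a) * gquot p q f h b + q a b * f (T b) * gquot p q f h a)) / f U"

lemma series_eqI:
  assumes "f U = g U" "\<And>a. f (T a) = g (T a)"
  shows "f = (g :: series)"
proof
  fix x show "f x = g x" using assms by (cases x) auto
qed

lemma series_eqI_tree:
  assumes "f U = g U" "\<And>i. f (T (Leaf i)) = g (T (Leaf i))"
    "\<And>a b. f (T (Node a b)) = g (T (Node a b))"
  shows "f = (g :: series)"
proof (rule series_eqI)
  fix a show "f (T a) = g (T a)" using assms by (cases a) auto
qed (use assms in simp)

lemma gmul_solvable:
  assumes "f U \<noteq> 0"
  shows "\<exists>g. gmul p q f g = h"
proof
  let ?g = "case_mon (h U / f U) (gquot p q f h)"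
  show "gmul p q f ?g = h"
  proof (rule series_eqI)
    fix a show "gmul p q f ?g (T a) = h (T a)"
      using assms by (cases a) (auto simp: field_simps)
  qed (use assms in simp)
qed

lemma gmul_cancel:
  assumes "f U \<noteq> 0" and eq: "gmul p q f g = gmul p q f g'"
  shows "g = g'"
proof (rule series_eqI)
  show U: "g U = g' U"
    using fun_cong[OF eq, of U] assms(1) by simp
  fix a show "g (T a) = g' (T a)"
  proof (induction a)
    case (Leaf i)
    then show ?case using fun_cong[OF eq, of "T (Leaf i)"] assms(1) U by simp
  next
    case (Node a b)
    then show ?case using fun_cong[OF eq, of "T (Node a b)"] assms(1) U by simp
  qed
qed

lemma nmul_eq_gmul: "nmul f g = gmul (\<lambda>_ _. 1) (\<lambda>_ _. 0) f g"
  by (rule series_eqI_tree) simp_all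

lemma nmul_eq_gmul_swap: "nmul g f = gmul (\<lambda>_ _. 0) (\<lambda>_ _. 1) f g"
  by (rule series_eqI_tree) simp_all

lemma cmul_eq_gmul: "cmul f g = gmul (\<lambda>_ _. 1) (\<lambda>a b. of_bool (\<not> ceq a b)) f g"
  by (rule series_eqI_tree) simp_all

section \<open>Commutative monomials and class functions\<close>

lemma ceq_sym: "ceq a b \<Longrightarrow> ceq b a"
  by (induction a b rule: ceq.induct) auto

lemma ceq_trans: "ceq a b \<Longrightarrow> ceq b d \<Longrightarrow> ceq a d"
proof (induction a arbitrary: b d)
  case (Leaf i)
  then show ?case by (cases b; cases d) auto
next
  case (Node a1 a2)
  then obtain b1 b2 d1 d2 where "b = Node b1 b2" "d = Node d1 d2"
    by (cases b; cases d) auto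
  with Node show ?case by (metis ceq.simps(2))
qed

lemma ceq_cong: "ceq a a' \<Longrightarrow> ceq b b' \<Longrightarrow> ceq a b = ceq a' b'"
  by (meson ceq_sym ceq_trans)

lemma cseriesI:
  assumes "\<And>a b. ceq a b \<Longrightarrow> f (T a) = f (T b)"
  shows "f \<in> cseries"
proof -
  have "f v = f w" if "ceqm v w" for v w
    using that assms by (cases v; cases w) auto
  then show ?thesis by (auto simp: cseries_def)
qed

lemma cseriesD: "f \<in> cseries \<Longrightarrow> ceq a b \<Longrightarrow> f (T a) = f (T b)"
  by (auto simp: cseries_def dest: spec[of _ "T a"])

lemma cmul_commute:
  assumes "f \<in> cseries" "g \<in> cseries"
  shows "cmul f g = cmul g f"
proof (rule series_eqI_tree)
  fix a b show "cmul f g (T (Node a b)) = cmul g f (T (Node a b))"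
    using cseriesD[OF assms(1), of a b] cseriesD[OF assms(2), of a b] by auto
qed simp_all

text \<open>Swapping the children exchanges the two summands, and on the diagonal all four children
  lie in one class.\<close>

lemma cmul_Node_swap:
  assumes "f \<in> cseries" "g \<in> cseries" "ceq (Node a b) (Node a' b')"
  shows "(if ceq a b then f (T a) * g (T b) else f (T a) * g (T b) + f (T b) * g (T a))
       = (if ceq a' b' then f (T a') * g (T b') else f (T a') * g (T b') + f (T b') * g (T a'))"
proof -
  note D = cseriesD[OF assms(1)] cseriesD[OF assms(2)]
  consider "ceq a a'" "ceq b b'" | "ceq a b'" "ceq b a'" using assms(3) by auto
  then show ?thesis
  proof cases
    case 1
    then show ?thesis using D[of a a'] D[of b b'] ceq_cong[of a a' b b'] by simp
  next
    case 2
    then have "ceq a b = ceq a' b'" using ceq_cong ceq_sym by metis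
    then show ?thesis using 2 D[of a b'] D[of b a'] D[of a' b']
      by (cases "ceq a' b'") simp_all
  qed
qed

lemma cmul_cseries:
  assumes "f \<in> cseries" "g \<in> cseries"
  shows "cmul f g \<in> cseries"
proof (rule cseriesI)
  fix x y assume "ceq x y"
  then show "cmul f g (T x) = cmul f g (T y)"
    using cseriesD[OF assms(1) \<open>ceq x y\<close>] cseriesD[OF assms(2) \<open>ceq x y\<close>]
      cmul_Node_swap[OF assms]
    by (cases x; cases y) auto
qed

text \<open>\<open>gmul_solvable\<close> finds a solution among all series, while
  \<open>cldiv\<close> asks for one in \<open>cseries\<close>. At equivalent nodes the mixed terms
  agree by induction, so comparing coefficients and dividing by \<open>f U\<close> gives equal
  values of \<open>g\<close>.\<close>

lemma cmul_quotient_cseries: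
  assumes f: "f \<in> cseries" "f U \<noteq> 0" and h: "cmul f g \<in> cseries"
  shows "g \<in> cseries"
proof (rule cseriesI)
  fix x y assume "ceq x y"
  then show "g (T x) = g (T y)"
  proof (induction x y rule: ceq.induct)
    case (1 i j)
    then show ?case by simp
  next
    case (2 a b a' b')
    have eq: "ceq a a' \<and> ceq b b' \<or> ceq a b' \<and> ceq b a'" using "2.prems" by simp
    have "(if ceq a b then f (T a) * g (T b) else f (T a) * g (T b) + f (T b) * g (T a))
       = (if ceq a' b' then f (T a') * g (T b') else f (T a') * g (T b') + f (T b') * g (T a'))"
      using eq
    proof
      assume A: "ceq a a' \<and> ceq b b'"
      then have "g (T a) = g (T a')" "g (T b) = g (T b')" using "2.IH" by auto
      then show ?thesis using A cseriesD[OF f(1), of a a'] cseriesD[OF f(1), of b b'] ceq_cong[of a a' b b']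
        by simp
    next
      assume A: "ceq a b' \<and> ceq b a'"
      then have g: "g (T a) = g (T b')" "g (T b) = g (T a')" using "2.IH" by auto
      have ab: "ceq a b = ceq a' b'" using A ceq_cong ceq_sym by metis
      \<comment> \<open>Off the diagonal the two summands change places. On it a single summand is
        left, and the matching \<open>ceq a a'\<close> has to be recovered by transitivity.\<close>
      show ?thesis
      proof (cases "ceq a b")
        case True
        then have "ceq a a'" using A ceq_trans by blast
        then have "g (T a) = g (T a')" "ceq a a'" using "2.IH" True A ceq_trans ceq_sym by blast+
        then show ?thesis using A ab g True cseriesD[OF f(1)] by auto
      next
        case False
        then show ?thesis using A ab g cseriesD[OF f(1), of a b'] cseriesD[OF f(1), of b a'] by simp
      qed
    qed
    moreover have "f (T (Node a b)) = f (T (Node a' b'))"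
      "cmul f g (T (Node a b)) = cmul f g (T (Node a' b'))"
      using "2.prems" cseriesD[OF f(1)] cseriesD[OF h] by blast+
    ultimately show ?case using f(2) by simp
  qed simp_all
qed

lemma nmul_nldiv:
  assumes "f U \<noteq> 0"
  shows "nmul f (nldiv f h) = h"
proof -
  obtain g where "nmul f g = h" using gmul_solvable[of f] assms nmul_eq_gmul by metis
  moreover have "g' = g" if "nmul f g' = h" for g'
    using gmul_cancel[of f] assms calculation that nmul_eq_gmul by metis
  ultimately show ?thesis unfolding nldiv_def by (rule theI)
qed

lemma nmul_nrdiv:
  assumes "f U \<noteq> 0"
  shows "nmul (nrdiv h f) f = h"
proof -
  obtain g where "nmul g f = h" using gmul_solvable[of f] assms nmul_eq_gmul_swap by metis
  moreover have "g' = g" if "nmul g' f = h" for g'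
    using gmul_cancel[of f] assms calculation that nmul_eq_gmul_swap by metis
  ultimately show ?thesis unfolding nrdiv_def by (rule theI)
qed

lemma cldiv_props:
  assumes "f U \<noteq> 0" "f \<in> cseries" "h \<in> cseries"
  shows "cldiv f h \<in> cseries" "cmul f (cldiv f h) = h" "cldiv f h U = h U / f U"
proof -
  obtain g where g: "cmul f g = h" using gmul_solvable[of f] assms(1) cmul_eq_gmul by metis
  have g': "g \<in> cseries" using cmul_quotient_cseries[of f g] g assms by simp
  have "cldiv f h = g" unfolding cldiv_def
  proof (rule the_equality)
    fix g' assume "g' \<in> cseries \<and> cmul f g' = h"
    then have "gmul (\<lambda>_ _. 1) (\<lambda>a b. of_bool (\<not> ceq a b)) f g'
      = gmul (\<lambda>_ _. 1) (\<lambda>a b. of_bool (\<not> ceq a b)) f g"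
      using g by (simp add: cmul_eq_gmul)
    then show "g' = g" using gmul_cancel[of f] assms(1) by blast
  qed (use g g' in simp)
  moreover have "f U * g U = h U" using g cmul.simps(1) by metis
  ultimately show "cldiv f h \<in> cseries" "cmul f (cldiv f h) = h" "cldiv f h U = h U / f U"
    using g g' assms(1) by (auto simp: field_simps)
qed

lemma crdiv_eq_cldiv:
  assumes "f \<in> cseries"
  shows "crdiv h f = cldiv f h"
  unfolding crdiv_def cldiv_def using cmul_commute[OF assms] by metis

section \<open>The Magnus map\<close>

text \<open>The flag \<open>c\<close> is that of \<open>loop_eq\<close>, so both halves of the
  theorem are proved at once.\<close>

definition pmul :: "bool \<Rightarrow> series \<Rightarrow> series \<Rightarrow> series" where
  "pmul c = (if c then cmul else nmul)"

definition mg :: "bool \<Rightarrow> ltm \<Rightarrow> series" where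
  "mg c = (if c then magnus_c else magnus)"

text \<open>Divisions are definite descriptions; a non-zero constant term is what makes them satisfy
  their equations, and the value 1 is inherited by every quotient.\<close>

lemma magnus_U: "magnus s U = 1"
proof (induction s)
  case (LDiv s t)
  then show ?case using fun_cong[OF nmul_nldiv[of "magnus s" "magnus t"], of U] by simp
next
  case (RDiv s t)
  then show ?case using fun_cong[OF nmul_nrdiv[of "magnus t" "magnus s"], of U] by simp
qed (auto simp: splus_def sone_def svar_def)

lemma magnus_c_U_cseries: "magnus_c s U = 1 \<and> magnus_c s \<in> cseries"
proof (induction s)
  case (Gen i)
  have "T a = T (Leaf i) \<longleftrightarrow> T b = T (Leaf i)" if "ceq a b" for a b
    using that by (cases a; cases b) auto
  then have "svar i \<in> cseries" by (intro cseriesI) (simp add: svar_def)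
  then show ?case by (auto simp: splus_def sone_def svar_def intro!: cseriesI dest: cseriesD)
next
  case One
  show ?case by (auto simp: sone_def intro!: cseriesI)
next
  case (Mul s t)
  then show ?case by (simp add: cmul_cseries)
next
  case (LDiv s t)
  then show ?case using cldiv_props[of "magnus_c s" "magnus_c t"] by simp
next
  case (RDiv t s)
  then show ?case using cldiv_props[of "magnus_c s" "magnus_c t"] by (simp add: crdiv_eq_cldiv)
qed

lemma mg_U [simp]: "mg c s U = 1"
  by (simp add: mg_def magnus_U magnus_c_U_cseries)

lemma mg_cseries: "c \<Longrightarrow> mg c s \<in> cseries"
  by (simp add: mg_def magnus_c_U_cseries)

lemma mg_One: "mg c One = sone"
  by (simp add: mg_def)

lemma mg_One_T [simp]: "mg c One (T a) = 0"
  by (simp add: mg_One sone_def)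

lemma mg_Gen: "mg c (Gen i) = splus sone (svar i)"
  by (simp add: mg_def)

lemma mg_Mul: "mg c (Mul s t) = pmul c (mg c s) (mg c t)"
  by (simp add: mg_def pmul_def)

lemma pmul_LDiv: "pmul c (mg c s) (mg c (LDiv s t)) = mg c t"
  using cldiv_props[of "magnus_c s" "magnus_c t"] magnus_c_U_cseries magnus_U
  by (auto simp: mg_def pmul_def intro!: nmul_nldiv)

lemma pmul_RDiv: "pmul c (mg c (RDiv t s)) (mg c s) = mg c t"
proof (cases c)
  case True
  then have "pmul c (mg c (RDiv t s)) (mg c s) = pmul c (mg c s) (mg c (RDiv t s))"
    using cmul_commute mg_cseries[of c] by (simp add: pmul_def)
  then show ?thesis using True pmul_LDiv[of c s t] magnus_c_U_cseries
    by (simp add: mg_def crdiv_eq_cldiv)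
next
  case False
  then show ?thesis using magnus_U by (auto simp: mg_def pmul_def intro!: nmul_nrdiv)
qed

lemma pmul_left_cancel:
  assumes "f U \<noteq> 0" "pmul c f g = pmul c f g'"
  shows "g = g'"
proof -
  have "gmul (\<lambda>_ _. 1) (\<lambda>a b. of_bool (c \<and> \<not> ceq a b)) f g
    = gmul (\<lambda>_ _. 1) (\<lambda>a b. of_bool (c \<and> \<not> ceq a b)) f g'"
    using assms(2) by (cases c) (simp_all add: pmul_def cmul_eq_gmul nmul_eq_gmul)
  with assms(1) show ?thesis by (rule gmul_cancel)
qed

lemma mg_left_cancel:
  assumes "pmul c (mg c s) (mg c t) = pmul c (mg c s) (mg c t')"
  shows "mg c t = mg c t'"
  using pmul_left_cancel[OF _ assms] by simp

lemma mg_right_cancel: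
  assumes "pmul c (mg c t) (mg c s) = pmul c (mg c t') (mg c s)"
  shows "mg c t = mg c t'"
proof (cases c)
  case True
  then show ?thesis using assms cmul_commute mg_cseries mg_left_cancel
    by (metis (full_types) pmul_def)
next
  case False
  then show ?thesis using assms unfolding pmul_def nmul_eq_gmul_swap
    by (auto intro: gmul_cancel[of "mg c s"])
qed

lemma pmul_One: "pmul c sone f = f" "pmul c f sone = f"
  by (rule series_eqI_tree; simp add: pmul_def sone_def)+

text \<open>This makes the Magnus map well defined on the free loop. Quotients are handled by
  multiplying back and cancelling series with constant term 1.\<close>

lemma mg_loop_eq: "loop_eq c s t \<Longrightarrow> mg c s = mg c t"
proof (induction rule: loop_eq.induct)
  case (cong_ldiv s s' t t')
  then show ?case using pmul_LDiv mg_left_cancel by metis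
next
  case (cong_rdiv s s' t t')
  then show ?case using pmul_RDiv mg_right_cancel by metis
next
  case (ldiv_mul s t)
  then show ?case using pmul_LDiv mg_left_cancel mg_Mul by metis
next
  case (rdiv_mul t s)
  then show ?case using pmul_RDiv mg_right_cancel mg_Mul by metis
next
  case (comm s t)
  then show ?case using cmul_commute mg_cseries by (simp add: mg_Mul pmul_def)
qed (auto simp: mg_Mul mg_One pmul_One pmul_LDiv pmul_RDiv)

text \<open>Halving on the diagonal makes the product of class functions the full
  symmetrisation of the tensor product, without a case distinction.\<close>

definition kap :: "bool \<Rightarrow> tree \<Rightarrow> tree \<Rightarrow> rat" where
  "kap c a b = (if c \<and> ceq a b then 1 / 2 else 1)"

lemma kap_nonzero: "kap c a b \<noteq> 0"
  by (simp add: kap_def)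

lemma mg_Mul_Node:
  "mg c (Mul u v) (T (Node a b)) = mg c u (T (Node a b)) + mg c v (T (Node a b))
    + kap c a b * (mg c u (T a) * mg c v (T b) + of_bool c * (mg c u (T b) * mg c v (T a)))"
proof -
  \<comment> \<open>On the diagonal both symmetrised products agree, so half of their sum is the
    single product in \<open>cmul\<close>.\<close>
  have "mg c u (T a) = mg c u (T b) \<and> mg c v (T a) = mg c v (T b)" if c "ceq a b"
    using that cseriesD mg_cseries by metis
  then show ?thesis by (cases c) (simp_all add: mg_Mul pmul_def kap_def)
qed

section \<open>Linear independence of the Magnus images\<close>

text \<open>Coefficients are indexed by terms, so two different members of \<open>S\<close> with the
  same image already count as dependent.\<close>

definition indep :: "bool \<Rightarrow> ltm set \<Rightarrow> bool" where
  "indep c S \<longleftrightarrow> (\<forall>d. (\<forall>x. (\<Sum>v\<in>S. d v * mg c v x) = 0) \<longrightarrow> (\<forall>v\<in>S. d v = 0))"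

lemma indepD: "indep c S \<Longrightarrow> (\<And>x. (\<Sum>v\<in>S. d v * mg c v x) = 0) \<Longrightarrow> v \<in> S \<Longrightarrow> d v = 0"
  by (auto simp: indep_def)

section \<open>Tensors of augmentation parts and their spans\<close>

definition prods :: "bool \<Rightarrow> ltm set \<Rightarrow> ltm \<Rightarrow> ltm \<Rightarrow> bool" where
  "prods c S u v \<longleftrightarrow> u \<in> S \<and> v \<in> S \<and> (\<exists>z\<in>S. loop_eq c (Mul u v) z)"

text \<open>Evaluating only at trees drops the constant term, so \<open>u\<close> enters through
  \<open>u' = M(u) - 1\<close>. No symmetrisation is built in: in the commutative case
  \<open>G\<close> carries both orders.\<close>

definition tens :: "bool \<Rightarrow> ltm set \<Rightarrow> (ltm \<Rightarrow> ltm \<Rightarrow> rat) \<Rightarrow> tree \<Rightarrow> tree \<Rightarrow> rat" where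
  "tens c S G a b = kap c a b * (\<Sum>u\<in>S. \<Sum>v\<in>S. G u v * mg c u (T a) * mg c v (T b))"

text \<open>The single tensors span it; it contains the symmetrised ones since \<open>prods\<close>
  is symmetric when \<open>c\<close> holds.\<close>

definition tspan :: "bool \<Rightarrow> ltm set \<Rightarrow> (tree \<Rightarrow> tree \<Rightarrow> rat) set" where
  "tspan c S = {tens c S G | G. \<forall>u v. G u v \<noteq> 0 \<longrightarrow> prods c S u v}"

definition node_part :: "bool \<Rightarrow> ltm \<Rightarrow> tree \<Rightarrow> tree \<Rightarrow> rat" where
  "node_part c z a b = mg c z (T (Node a b))"

lemma tens_add: "tens c S G a b + tens c S H a b = tens c S (\<lambda>u v. G u v + H u v) a b"
  by (simp add: tens_def sum.distrib distrib_left distrib_right)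

lemma tens_scale: "r * tens c S G a b = tens c S (\<lambda>u v. r * G u v) a b"
  by (simp add: tens_def sum_distrib_left mult_ac)

lemma tspan_add:
  assumes "f \<in> tspan c S" "g \<in> tspan c S"
  shows "(\<lambda>a b. f a b + g a b) \<in> tspan c S"
proof -
  obtain G H where "f = tens c S G" "g = tens c S H"
    "\<forall>u v. G u v \<noteq> 0 \<longrightarrow> prods c S u v" "\<forall>u v. H u v \<noteq> 0 \<longrightarrow> prods c S u v"
    using assms by (auto simp: tspan_def)
  then have "(\<lambda>a b. f a b + g a b) = tens c S (\<lambda>u v. G u v + H u v)"
    "\<forall>u v. G u v + H u v \<noteq> 0 \<longrightarrow> prods c S u v"
    by (auto simp: tens_add) (metis add.right_neutral)
  then show ?thesis unfolding tspan_def by blast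
qed

lemma tspan_scale:
  assumes "f \<in> tspan c S"
  shows "(\<lambda>a b. r * f a b) \<in> tspan c S"
proof -
  obtain G where "f = tens c S G" "\<forall>u v. G u v \<noteq> 0 \<longrightarrow> prods c S u v"
    using assms by (auto simp: tspan_def)
  then have "(\<lambda>a b. r * f a b) = tens c S (\<lambda>u v. r * G u v)"
    "\<forall>u v. r * G u v \<noteq> 0 \<longrightarrow> prods c S u v"
    by (auto simp: tens_scale)
  then show ?thesis unfolding tspan_def by blast
qed

lemma tspan_diff:
  assumes "f \<in> tspan c S" "g \<in> tspan c S"
  shows "(\<lambda>a b. f a b - g a b) \<in> tspan c S"
  using tspan_add[OF assms(1) tspan_scale[OF assms(2), of "-1"]] by simp

lemma tspan_zero: "(\<lambda>a b. 0) \<in> tspan c S"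
proof -
  have "(\<lambda>a b. 0) = tens c S (\<lambda>u v. 0)" by (intro ext) (simp add: tens_def)
  then show ?thesis unfolding tspan_def by blast
qed

lemma tspan_sum:
  assumes "finite A" "\<And>x. x \<in> A \<Longrightarrow> f x \<in> tspan c S"
  shows "(\<lambda>a b. \<Sum>x\<in>A. d x * f x a b) \<in> tspan c S"
  using assms
proof (induction A)
  case empty
  then show ?case by (simp add: tspan_zero)
next
  case (insert x A)
  then have "(\<lambda>a b. d x * f x a b + (\<Sum>x\<in>A. d x * f x a b)) \<in> tspan c S"
    by (intro tspan_add tspan_scale) auto
  then show ?case using insert.hyps by simp
qed

text \<open>Coefficients supported on \<open>prods c S\<close> vanish outside \<open>S\<close>, so
  the same \<open>G\<close> serves for the larger family.\<close>

lemma tspan_mono: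
  assumes "S \<subseteq> S'" "finite S'"
  shows "tspan c S \<subseteq> tspan c S'"
proof
  fix f assume "f \<in> tspan c S"
  then obtain G where G: "f = tens c S G" "\<forall>u v. G u v \<noteq> 0 \<longrightarrow> prods c S u v"
    by (auto simp: tspan_def)
  have 0: "G u v = 0" if "u \<notin> S \<or> v \<notin> S" for u v
    using G(2) that unfolding prods_def by blast
  have "tens c S G a b = tens c S' G a b" for a b
  proof -
    have "(\<Sum>u\<in>S. \<Sum>v\<in>S. G u v * mg c u (T a) * mg c v (T b))
      = (\<Sum>u\<in>S. \<Sum>v\<in>S'. G u v * mg c u (T a) * mg c v (T b))"
      using assms 0 by (intro sum.cong sum.mono_neutral_left) auto
    also have "\<dots> = (\<Sum>u\<in>S'. \<Sum>v\<in>S'. G u v * mg c u (T a) * mg c v (T b))"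
      using assms 0 by (intro sum.mono_neutral_left) auto
    finally show ?thesis by (simp add: tens_def)
  qed
  then have "f = tens c S' G" using G(1) by auto
  moreover have "\<forall>u v. G u v \<noteq> 0 \<longrightarrow> prods c S' u v"
    using G(2) assms(1) unfolding prods_def by blast
  ultimately show "f \<in> tspan c S'" unfolding tspan_def by blast
qed

text \<open>Once \<open>w\<close> is assumed dependent on \<open>S\<close>, this expands
  \<open>s' \<otimes> w'\<close> into tensors of members of \<open>S\<close>.\<close>

lemma tens_left:
  assumes "finite S" "s \<in> S"
  shows "tens c S (\<lambda>u v. of_bool (u = s) * d v) a b
    = kap c a b * (mg c s (T a) * (\<Sum>v\<in>S. d v * mg c v (T b)))"
proof -
  have "(\<Sum>v\<in>S. of_bool (u = s) * d v * mg c u (T a) * mg c v (T b))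
    = (if u = s then mg c s (T a) * (\<Sum>v\<in>S. d v * mg c v (T b)) else 0)" for u
    by (simp add: sum_distrib_left mult_ac)
  then show ?thesis using assms by (simp add: tens_def)
qed

lemma tens_right:
  assumes "finite S" "s \<in> S"
  shows "tens c S (\<lambda>u v. of_bool (v = s) * d u) a b
    = kap c a b * ((\<Sum>v\<in>S. d v * mg c v (T a)) * mg c s (T b))"
proof -
  have "(\<Sum>v\<in>S. of_bool (v = s) * d u * mg c u (T a) * mg c v (T b))
    = d u * mg c u (T a) * mg c s (T b)" for u
  proof -
    have "(\<Sum>v\<in>S. of_bool (v = s) * d u * mg c u (T a) * mg c v (T b))
      = (\<Sum>v\<in>S. if v = s then d u * mg c u (T a) * mg c s (T b) else 0)"
      by (intro sum.cong) auto
    then show ?thesis using assms by simp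
  qed
  then show ?thesis by (simp add: tens_def sum_distrib_right)
qed

lemma tens_pair:
  assumes "finite S" "s \<in> S" "t \<in> S"
  shows "tens c S (\<lambda>u v. of_bool (u = s) * of_bool (v = t)) a b
    = kap c a b * (mg c s (T a) * mg c t (T b))"
proof -
  have "(\<Sum>v\<in>S. of_bool (v = t) * mg c v (T b)) = (\<Sum>v\<in>S. if v = t then mg c t (T b) else 0)"
    by (intro sum.cong) auto
  then show ?thesis using assms by (simp add: tens_left)
qed

lemma tspan_pair:
  assumes "finite S" "prods c S s t"
  shows "(\<lambda>a b. kap c a b * (mg c s (T a) * mg c t (T b))) \<in> tspan c S"
proof -
  have "s \<in> S" "t \<in> S" using assms(2) by (auto simp: prods_def)
  then have "(\<lambda>a b. kap c a b * (mg c s (T a) * mg c t (T b)))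
    = tens c S (\<lambda>u v. of_bool (u = s) * of_bool (v = t))"
    by (intro ext) (simp add: tens_pair[OF assms(1)])
  moreover have "\<forall>u v. of_bool (u = s) * of_bool (v = t) \<noteq> (0 :: rat) \<longrightarrow> prods c S u v"
    using assms(2) by auto
  ultimately show ?thesis unfolding tspan_def by blast
qed

text \<open>All constant terms are 1, so a relation between the augmentation parts lifts to
  a relation between the series once the coefficient of the identity is adjusted.\<close>

lemma indep_tree:
  assumes S: "finite S" "One \<in> S" "indep c S"
    and 0: "\<And>a. (\<Sum>v\<in>S. d v * mg c v (T a)) = 0" and v: "v \<in> S" "v \<noteq> One"
  shows "d v = 0"
proof -
  let ?e = "d(One := - (\<Sum>v\<in>S - {One}. d v))"
  have split: "(\<Sum>v\<in>S. f v) = f One + (\<Sum>v\<in>S - {One}. f v)" for f :: "ltm \<Rightarrow> rat"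
    using S by (simp add: sum.remove)
  have "(\<Sum>v\<in>S. ?e v * mg c v x) = 0" for x
  proof (cases x)
    case U
    then show ?thesis by (simp add: split)
  next
    case (T a)
    then show ?thesis using 0[of a] by (simp add: split)
  qed
  then have "?e v = 0" by (rule indepD[OF S(3) _ v(1)])
  then show ?thesis using v by simp
qed

text \<open>Tensors of independent vectors are independent: for fixed \<open>b\<close> the
  hypothesis is a relation among the \<open>u'\<close>, whose coefficients are in turn relations
  among the \<open>v'\<close>. \<open>One\<close> is excluded because its augmentation part is
  0.\<close>

lemma tens_unique:
  assumes S: "finite S" "One \<in> S" "indep c S"
    and 0: "\<And>a b. tens c S G a b = 0"
    and "u \<in> S" "u \<noteq> One" "v \<in> S" "v \<noteq> One"
  shows "G u v = 0"
proof -
  have "(\<Sum>v\<in>S. G u v * mg c v (T b)) = 0" for b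
  proof -
    have "(\<Sum>u\<in>S. (\<Sum>v\<in>S. G u v * mg c v (T b)) * mg c u (T a)) = 0" for a
    proof -
      have "(\<Sum>u\<in>S. \<Sum>v\<in>S. G u v * mg c u (T a) * mg c v (T b)) = 0"
        using 0[of a b] kap_nonzero by (simp add: tens_def)
      then show ?thesis by (simp add: sum_distrib_left sum_distrib_right mult_ac)
    qed
    with S show ?thesis using assms(5,6) by (rule indep_tree)
  qed
  with S show ?thesis using assms(7,8) by (rule indep_tree)
qed

text \<open>Two coefficient systems with the same tensor agree away from \<open>One\<close> by
  \<open>tens_unique\<close>, and one of them is supported on \<open>prods\<close>.\<close>

lemma tspan_unique:
  assumes S: "finite S" "One \<in> S" "indep c S"
    and H: "tens c S H \<in> tspan c S"
    and uv: "u \<in> S" "u \<noteq> One" "v \<in> S" "v \<noteq> One" "\<not> prods c S u v"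
  shows "H u v = 0"
proof -
  obtain G where G: "tens c S H = tens c S G" "\<forall>u v. G u v \<noteq> 0 \<longrightarrow> prods c S u v"
    using H by (auto simp: tspan_def)
  have "tens c S (\<lambda>u v. H u v + (-1) * G u v) a b = 0" for a b
    using G(1) by (simp only: tens_add[symmetric] tens_scale[symmetric])
  from tens_unique[OF S this, of u v] have "H u v = G u v" using uv by simp
  then show ?thesis using G(2) uv by auto
qed

section \<open>Closed families and the adjunction of products\<close>

lemma indep_insert:
  assumes S: "finite S" "indep c S" and w: "w \<notin> S"
    and no: "\<not> (\<exists>d. \<forall>x. mg c w x = (\<Sum>v\<in>S. d v * mg c v x))"
  shows "indep c (insert w S)"
  unfolding indep_def
proof (intro allI impI)
  fix d assume 0: "\<forall>x. (\<Sum>v\<in>insert w S. d v * mg c v x) = 0"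
  then have 0: "d w * mg c w x + (\<Sum>v\<in>S. d v * mg c v x) = 0" for x
    using S w by simp
  have "d w = 0"
  proof (rule ccontr)
    assume nz: "d w \<noteq> 0"
    have "mg c w x = (\<Sum>v\<in>S. (- d v / d w) * mg c v x)" for x
    proof -
      have "mg c w x = - (\<Sum>v\<in>S. d v * mg c v x) / d w"
        using 0[of x] nz by (simp add: field_simps eq_neg_iff_add_eq_0)
      then show ?thesis by (simp add: sum_divide_distrib sum_negf)
    qed
    then have "\<forall>x. mg c w x = (\<Sum>v\<in>S. (- d v / d w) * mg c v x)" by blast
    with no show False by (auto dest: spec[of _ "\<lambda>v. - d v / d w"])
  qed
  moreover have "\<forall>v\<in>S. d v = 0" using 0 calculation indepD[OF S(2), of d] by simp
  ultimately show "\<forall>v\<in>insert w S. d v = 0" by simp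
qed

text \<open>The condition on \<open>node_part\<close> is what the induction keeps of the idea that
  \<open>S\<close> contains the subterms from which its members are built.\<close>

definition closed_family :: "bool \<Rightarrow> ltm set \<Rightarrow> bool" where
  "closed_family c S \<longleftrightarrow> finite S \<and> One \<in> S \<and> indep c S \<and> (\<forall>z\<in>S. node_part c z \<in> tspan c S)"

lemma closed_family_insert:
  assumes "closed_family c S" "indep c (insert w S)" "node_part c w \<in> tspan c (insert w S)"
  shows "closed_family c (insert w S)"
  using assms tspan_mono[of S "insert w S" c] unfolding closed_family_def by auto

lemma node_part_Mul:
  "node_part c (Mul u v) a b = node_part c u a b + node_part c v a b
    + (kap c a b * (mg c u (T a) * mg c v (T b)) + of_bool c * (kap c a b * (mg c v (T a) * mg c u (T b))))"
  by (simp add: node_part_def mg_Mul_Node algebra_simps)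

lemma node_part_cong: "loop_eq c s t \<Longrightarrow> node_part c s = node_part c t"
  by (intro ext) (simp add: node_part_def mg_loop_eq)

lemma prods_commute: "c \<Longrightarrow> prods c S u v \<Longrightarrow> prods c S v u"
  unfolding prods_def by (meson loop_eq.comm loop_eq.trans)

lemma tspan_products:
  assumes "finite S" "prods c S s t"
  shows "(\<lambda>a b. kap c a b * (mg c s (T a) * mg c t (T b))
    + of_bool c * (kap c a b * (mg c t (T a) * mg c s (T b)))) \<in> tspan c S"
proof (cases c)
  case True
  then show ?thesis
    using tspan_add[OF tspan_pair[OF assms] tspan_pair[OF assms(1) prods_commute[OF True assms(2)]]]
    by simp
next
  case False
  then show ?thesis using tspan_pair[OF assms] by simp
qed

lemma closed_family_Mul:
  assumes S: "closed_family c S" and st: "s \<in> S" "t \<in> S"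
    and new: "\<And>v. v \<in> S \<Longrightarrow> \<not> loop_eq c (Mul s t) v"
  shows "closed_family c (insert (Mul s t) S)"
proof -
  let ?w = "Mul s t"
  have fin: "finite S" and one: "One \<in> S" and ind: "indep c S"
    and np: "\<And>z. z \<in> S \<Longrightarrow> node_part c z \<in> tspan c S"
    using S by (auto simp: closed_family_def)
  have w: "?w \<notin> S" using new loop_eq.refl by blast
  have st1: "s \<noteq> One" "t \<noteq> One"
    using new[OF st(2)] new[OF st(1)] loop_eq.one_left loop_eq.one_right by blast+
  have notprods: "\<not> prods c S s t" using new by (auto simp: prods_def)
  have "\<not> (\<exists>d. \<forall>x. mg c ?w x = (\<Sum>v\<in>S. d v * mg c v x))"
  proof
    assume "\<exists>d. \<forall>x. mg c ?w x = (\<Sum>v\<in>S. d v * mg c v x)"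
    then obtain d where d: "\<And>x. mg c ?w x = (\<Sum>v\<in>S. d v * mg c v x)" by blast
    \<comment> \<open>These coefficients give \<open>s' \<otimes> t'\<close>, together with
      \<open>t' \<otimes> s'\<close> in the commutative case. Comparing node coefficients in the
      relation expresses this tensor by node parts of members of \<open>S\<close>.\<close>
    let ?H = "\<lambda>u v. of_bool (u = s) * of_bool (v = t) + of_bool c * (of_bool (u = t) * of_bool (v = s)) :: rat"
    have tens_H: "tens c S ?H a b
      = (\<Sum>v\<in>S. d v * node_part c v a b) - node_part c s a b - node_part c t a b" for a b
      using node_part_Mul[of c s t a b] d[of "T (Node a b)"]
      by (simp add: tens_add[symmetric] tens_scale[symmetric] tens_pair[OF fin] st node_part_def)
    have "tens c S ?H
      = (\<lambda>a b. (\<Sum>v\<in>S. d v * node_part c v a b) - node_part c s a b - node_part c t a b)"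
      by (intro ext tens_H)
    moreover have "\<dots> \<in> tspan c S"
      by (intro tspan_diff[of "\<lambda>a b. _ a b - _ a b"] tspan_diff tspan_sum fin np st)
    ultimately have "?H s t = 0"
      using tspan_unique[OF fin one ind, of ?H s t] st st1 notprods by simp
    \<comment> \<open>The value is 2 if \<open>c\<close> holds and \<open>s = t\<close>, and 1
      otherwise, so symmetrising never cancels it.\<close>
    moreover have "?H s t > 0" by (auto simp: of_bool_def)
    ultimately show False by simp
  qed
  then have "indep c (insert ?w S)" using indep_insert fin ind w by blast
  moreover have "node_part c ?w \<in> tspan c (insert ?w S)"
  proof -
    have "prods c (insert ?w S) s t" using st loop_eq.refl by (auto simp: prods_def)
    then have "(\<lambda>a b. node_part c s a b + node_part c t a b + (kap c a b * (mg c s (T a) * mg c t (T b))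
      + of_bool c * (kap c a b * (mg c t (T a) * mg c s (T b))))) \<in> tspan c (insert ?w S)"
      using tspan_mono[of S "insert ?w S" c] fin np st
      by (intro tspan_add[of "\<lambda>a b. _ a b + _ a b"] tspan_add[of "node_part _ _"] tspan_products) auto
    moreover have "node_part c ?w = (\<lambda>a b. node_part c s a b + node_part c t a b
      + (kap c a b * (mg c s (T a) * mg c t (T b))
      + of_bool c * (kap c a b * (mg c t (T a) * mg c s (T b)))))"
      by (intro ext node_part_Mul)
    ultimately show ?thesis by simp
  qed
  ultimately show ?thesis by (rule closed_family_insert[OF S])
qed

section \<open>Bilinearity and the adjunction of quotients\<close>

lemma pmul_sum_right:
  "pmul c f (\<lambda>x. \<Sum>v\<in>A. d v * g v x) x = (\<Sum>v\<in>A. d v * pmul c f (g v) x)"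
proof (cases x)
  case (T a)
  then show ?thesis
    by (cases c; cases a)
      (simp_all add: pmul_def sum.distrib sum_distrib_left sum_distrib_right algebra_simps)
qed (cases c; simp add: pmul_def sum_distrib_left sum_distrib_right algebra_simps)

lemma pmul_sum_left:
  "pmul c (\<lambda>x. \<Sum>v\<in>A. d v * g v x) f x = (\<Sum>v\<in>A. d v * pmul c (g v) f x)"
proof (cases x)
  case (T a)
  then show ?thesis
    by (cases c; cases a)
      (simp_all add: pmul_def sum.distrib sum_distrib_left sum_distrib_right algebra_simps)
qed (cases c; simp add: pmul_def sum_distrib_left sum_distrib_right algebra_simps)

text \<open>Solving \<open>op_mul left s w\<close> for \<open>w\<close> gives the left quotient if
  \<open>left\<close> holds and the right quotient otherwise, so one argument treats both.\<close>

definition op_mul :: "bool \<Rightarrow> ltm \<Rightarrow> ltm \<Rightarrow> ltm" where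
  "op_mul left u v = (if left then Mul u v else Mul v u)"

lemma op_mul_One: "loop_eq c (op_mul left u One) u" "loop_eq c (op_mul left One u) u"
  by (auto simp: op_mul_def intro: loop_eq.one_left loop_eq.one_right)

lemma op_mul_cancel:
  assumes "loop_eq c (op_mul left s v) (op_mul left s v')"
  shows "loop_eq c v v'"
proof (cases left)
  case True
  then have "loop_eq c (LDiv s (Mul s v)) (LDiv s (Mul s v'))"
    using assms by (auto simp: op_mul_def intro: loop_eq.cong_ldiv loop_eq.refl)
  then show ?thesis by (meson loop_eq.ldiv_mul loop_eq.sym loop_eq.trans)
next
  case False
  then have "loop_eq c (RDiv (Mul v s) s) (RDiv (Mul v' s) s)"
    using assms by (auto simp: op_mul_def intro: loop_eq.cong_rdiv loop_eq.refl)
  then show ?thesis by (meson loop_eq.rdiv_mul loop_eq.sym loop_eq.trans)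
qed

lemma mg_op_mul_sum:
  assumes "\<And>x. mg c w x = (\<Sum>v\<in>S. d v * mg c v x)"
  shows "mg c (op_mul left s w) x = (\<Sum>v\<in>S. d v * mg c (op_mul left s v) x)"
proof -
  have "mg c w = (\<lambda>x. \<Sum>v\<in>S. d v * mg c v x)" using assms by auto
  then show ?thesis by (simp add: op_mul_def mg_Mul pmul_sum_left pmul_sum_right)
qed

text \<open>Without commutativity exactly one order of the tensor occurs, selected by
  \<open>left\<close>; with it both occur.\<close>

lemma node_part_op_mul:
  "node_part c (op_mul left u v) a b = node_part c u a b + node_part c v a b
    + (of_bool (left \<or> c) * (kap c a b * (mg c u (T a) * mg c v (T b)))
      + of_bool (\<not> left \<or> c) * (kap c a b * (mg c v (T a) * mg c u (T b))))"
  by (cases left; cases c) (simp_all add: op_mul_def node_part_Mul)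

lemma prods_op_mul:
  assumes "prods c S u v"
  shows "left \<or> c \<Longrightarrow> \<exists>z\<in>S. loop_eq c (op_mul left u v) z"
    and "\<not> left \<or> c \<Longrightarrow> \<exists>z\<in>S. loop_eq c (op_mul left v u) z"
  using assms prods_commute[of c S u v] by (cases left; auto simp: prods_def op_mul_def)+

lemma closed_family_quotient:
  assumes S: "closed_family c S" and st: "s \<in> S" "t \<in> S"
    and new: "\<And>v. v \<in> S \<Longrightarrow> \<not> loop_eq c w v"
    and wt: "loop_eq c (op_mul left s w) t"
  shows "closed_family c (insert w S)"
proof -
  have fin: "finite S" and one: "One \<in> S" and ind: "indep c S"
    and np: "\<And>z. z \<in> S \<Longrightarrow> node_part c z \<in> tspan c S"
    using S by (auto simp: closed_family_def)
  have w: "w \<notin> S" using new loop_eq.refl by blast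
  have s1: "s \<noteq> One"
    using new[OF st(2)] wt op_mul_One(2) loop_eq.sym loop_eq.trans by metis
  note node = node_part_op_mul[of c left s w]
  have node_t: "node_part c (op_mul left s w) = node_part c t"
    using wt by (rule node_part_cong)
  have "\<not> (\<exists>d. \<forall>x. mg c w x = (\<Sum>v\<in>S. d v * mg c v x))"
  proof
    assume "\<exists>d. \<forall>x. mg c w x = (\<Sum>v\<in>S. d v * mg c v x)"
    then obtain d where d: "\<And>x. mg c w x = (\<Sum>v\<in>S. d v * mg c v x)" by blast
    \<comment> \<open>The coefficients of \<open>s' \<otimes> w'\<close> or
      \<open>w' \<otimes> s'\<close>, or of their sum if \<open>c\<close> holds, after
      \<open>w'\<close> is replaced by its expansion.\<close>
    let ?H = "\<lambda>u v. of_bool (left \<or> c) * (of_bool (u = s) * d v)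
      + of_bool (\<not> left \<or> c) * (of_bool (v = s) * d u)"
    have tens_H: "tens c S ?H a b
      = node_part c t a b - node_part c s a b - (\<Sum>v\<in>S. d v * node_part c v a b)" for a b
    proof -
      have "(\<Sum>v\<in>S. d v * node_part c v a b) = node_part c w a b"
        by (simp add: node_part_def d)
      moreover have "tens c S ?H a b
        = of_bool (left \<or> c) * (kap c a b * (mg c s (T a) * mg c w (T b)))
          + of_bool (\<not> left \<or> c) * (kap c a b * (mg c w (T a) * mg c s (T b)))"
        by (simp only: tens_add[symmetric] tens_scale[symmetric] tens_left[OF fin st(1)]
            tens_right[OF fin st(1)] d[symmetric])
      ultimately show ?thesis using node[of a b] node_t by simp
    qed
    have "tens c S ?H
      = (\<lambda>a b. node_part c t a b - node_part c s a b - (\<Sum>v\<in>S. d v * node_part c v a b))"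
      by (intro ext tens_H)
    moreover have "\<dots> \<in> tspan c S"
      by (intro tspan_diff[OF tspan_diff] tspan_sum fin np st)
    ultimately have H: "?H u v = 0"
      if "u \<in> S" "u \<noteq> One" "v \<in> S" "v \<noteq> One" "\<not> prods c S u v" for u v
      using tspan_unique[OF fin one ind, of ?H u v] that by simp
    have "\<exists>z\<in>S. loop_eq c (op_mul left s v) z" if v: "v \<in> S" "d v \<noteq> 0" for v
    proof (rule ccontr)
      assume no: "\<not> ?thesis"
      then have v1: "v \<noteq> One" using op_mul_One(1) st(1) by blast
      show False
      proof (cases "left \<or> c")
        case True
        then have "\<not> prods c S s v" using prods_op_mul(1) no by blast
        \<comment> \<open>If \<open>v = s\<close> in the commutative case, both summands contribute
          and the value is \<open>2 * d s\<close>, still non-zero.\<close>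
        then show False using H[of s v] True v v1 s1 st by (cases "v = s"; cases c) auto
      next
        case False
        then have "\<not> prods c S v s" using prods_op_mul(2) no by blast
        then show False using H[of v s] False v v1 s1 st by (cases "v = s") auto
      qed
    qed
    then obtain z where z: "\<And>v. v \<in> S \<Longrightarrow> d v \<noteq> 0 \<Longrightarrow> z v \<in> S \<and> loop_eq c (op_mul left s v) (z v)"
      by metis
    \<comment> \<open>The relation equates M(\<open>t\<close>) with the sum of the
      \<open>d v\<close> M(\<open>z v\<close>); its coefficients are collected over the fibres of
      \<open>z\<close>.\<close>
    let ?e = "\<lambda>u. of_bool (u = t) - (\<Sum>v\<in>S. of_bool (z v = u) * d v)"
    have "(\<Sum>u\<in>S. ?e u * mg c u x) = 0" for x
    proof -
      have "mg c t x = (\<Sum>v\<in>S. d v * mg c (op_mul left s v) x)"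
        unfolding mg_loop_eq[OF wt, symmetric] by (rule mg_op_mul_sum[OF d])
      also have "\<dots> = (\<Sum>v\<in>S. \<Sum>u\<in>S. of_bool (z v = u) * d v * mg c u x)"
      proof (rule sum.cong)
        fix v assume v: "v \<in> S"
        show "d v * mg c (op_mul left s v) x = (\<Sum>u\<in>S. of_bool (z v = u) * d v * mg c u x)"
        proof (cases "d v = 0")
          case False
          then have "(\<Sum>u\<in>S. of_bool (z v = u) * d v * mg c u x)
            = (\<Sum>u\<in>S. if u = z v then d v * mg c (z v) x else 0)"
            by (intro sum.cong) auto
          then show ?thesis using z[OF v False] fin mg_loop_eq by auto
        qed simp
      qed simp
      also have "\<dots> = (\<Sum>u\<in>S. \<Sum>v\<in>S. of_bool (z v = u) * d v * mg c u x)"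
        by (rule sum.swap)
      also have "\<dots> = (\<Sum>u\<in>S. (\<Sum>v\<in>S. of_bool (z v = u) * d v) * mg c u x)"
        by (simp add: sum_distrib_right)
      finally have "mg c t x = \<dots>" .
      moreover have "(\<Sum>u\<in>S. of_bool (u = t) * mg c u x) = (\<Sum>u\<in>S. if u = t then mg c t x else 0)"
        by (intro sum.cong) auto
      ultimately show ?thesis using fin st by (simp add: left_diff_distrib sum_subtractf)
    qed
    then have "?e t = 0" using indepD[OF ind, of ?e t] st by blast
    \<comment> \<open>If \<open>d v \<noteq> 0\<close> and \<open>z v = t\<close>, the products of
      \<open>s\<close> with \<open>v\<close> and with \<open>w\<close> are equal, and cancelling
      \<open>s\<close> puts \<open>w\<close> in the class of \<open>v\<close>. Hence
      \<open>?e t\<close> is 1, against independence.\<close>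
    moreover have "(\<Sum>v\<in>S. of_bool (z v = t) * d v) = 0"
    proof (intro sum.neutral ballI)
      fix v assume v: "v \<in> S"
      have "z v \<noteq> t" if "d v \<noteq> 0"
      proof
        assume "z v = t"
        then have "loop_eq c (op_mul left s w) (op_mul left s v)"
          using z[OF v that] wt loop_eq.sym loop_eq.trans by metis
        then show False using op_mul_cancel new[OF v] by blast
      qed
      then show "of_bool (z v = t) * d v = 0" by auto
    qed
    ultimately show False by simp
  qed
  then have "indep c (insert w S)" using indep_insert fin ind w by blast
  moreover have "node_part c w \<in> tspan c (insert w S)"
  proof -
    let ?S = "insert w S"
    have np': "node_part c z \<in> tspan c ?S" if "z \<in> S" for z
      using tspan_mono[of S ?S c] np[OF that] fin by auto
    \<comment> \<open>The product formula is solved for \<open>w\<close>. Tensors with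
      \<open>w\<close> are now admissible because the product of \<open>s\<close> and
      \<open>w\<close> is represented by \<open>t\<close>.\<close>
    have "node_part c w = (\<lambda>a b. node_part c t a b - node_part c s a b
      - (of_bool (left \<or> c) * (kap c a b * (mg c s (T a) * mg c w (T b)))
        + of_bool (\<not> left \<or> c) * (kap c a b * (mg c w (T a) * mg c s (T b)))))"
      using node node_t by (intro ext) simp
    moreover have "(\<lambda>a b. of_bool (left \<or> c) * (kap c a b * (mg c s (T a) * mg c w (T b)))
        + of_bool (\<not> left \<or> c) * (kap c a b * (mg c w (T a) * mg c s (T b)))) \<in> tspan c ?S"
    proof (cases left)
      case True
      then have "prods c ?S s w" using wt st by (auto simp: prods_def op_mul_def)
      then show ?thesis using tspan_products[of ?S c s w] fin True by simp
    next
      case False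
      then have "prods c ?S w s" using wt st by (auto simp: prods_def op_mul_def)
      then show ?thesis using tspan_products[of ?S c w s] fin False by (simp add: add.commute)
    qed
    ultimately show ?thesis
      using tspan_diff[OF tspan_diff[OF np'[OF st(2)] np'[OF st(1)]]] by simp
  qed
  ultimately show ?thesis by (rule closed_family_insert[OF S])
qed

section \<open>The initial family and its extension along terms\<close>

lemma closed_family_gens: "closed_family c (insert One (Gen ` {1..n}))"
proof -
  let ?S = "insert One (Gen ` {1..n})"
  have "indep c ?S"
    unfolding indep_def
  proof (intro allI impI)
    fix d assume 0: "\<forall>x. (\<Sum>v\<in>?S. d v * mg c v x) = 0"
    \<comment> \<open>The coefficient at \<open>Leaf i\<close> singles out \<open>Gen i\<close>; the
      constant term then leaves \<open>d One\<close> alone.\<close>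
    have gen: "d (Gen i) = 0" if "i \<in> {1..n}" for i
    proof -
      have "(\<Sum>v\<in>?S. d v * mg c v (T (Leaf i))) = (\<Sum>v\<in>{Gen i}. d v * mg c v (T (Leaf i)))"
        using that by (intro sum.mono_neutral_right)
          (auto simp: mg_Gen splus_def sone_def svar_def split: if_splits)
      then show ?thesis using 0 by (simp add: mg_Gen splus_def sone_def svar_def)
    qed
    have "(\<Sum>v\<in>?S. d v * mg c v U) = d One + (\<Sum>v\<in>Gen ` {1..n}. d v)"
      by (subst sum.insert) auto
    moreover have "(\<Sum>v\<in>Gen ` {1..n}. d v) = 0" using gen by (intro sum.neutral) auto
    ultimately have "d One = 0" using spec[OF 0, of U] by linarith
    then show "\<forall>v\<in>?S. d v = 0" using gen by auto
  qed
  moreover have "node_part c z \<in> tspan c ?S" if "z \<in> ?S" for z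
  proof -
    have "node_part c z = (\<lambda>a b. 0)"
      using that by (intro ext) (auto simp: node_part_def mg_Gen splus_def sone_def svar_def)
    then show ?thesis by (simp add: tspan_zero)
  qed
  ultimately show ?thesis by (auto simp: closed_family_def)
qed

text \<open>An element already represented must not be adjoined again: two representatives would
  have the same image and destroy independence.\<close>

lemma closed_family_add:
  assumes "closed_family c S" "loop_eq c s w"
    and "(\<And>v. v \<in> S \<Longrightarrow> \<not> loop_eq c w v) \<Longrightarrow> closed_family c (insert w S)"
  shows "\<exists>S'. closed_family c S' \<and> S \<subseteq> S' \<and> (\<exists>s'\<in>S'. loop_eq c s s')"
proof (cases "\<exists>v\<in>S. loop_eq c w v")
  case True
  then obtain v where "v \<in> S" "loop_eq c s v" using assms(2) loop_eq.trans by blast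
  then show ?thesis using assms(1) by blast
next
  case False
  then have "closed_family c (insert w S)" using assms(3) by blast
  then show ?thesis using assms(2) by blast
qed

text \<open>The second argument of an operation is treated over the family obtained from the first,
  so both representatives lie in one family, and the operation is applied to these
  representatives.\<close>

lemma closed_family_extend:
  assumes "closed_family c S" "Gen ` gens s \<subseteq> S"
  shows "\<exists>S'. closed_family c S' \<and> S \<subseteq> S' \<and> (\<exists>s'\<in>S'. loop_eq c s s')"
  using assms
proof (induction s arbitrary: S)
  case (Gen i)
  then show ?case using loop_eq.refl by auto
next
  case One
  then have "One \<in> S" by (simp add: closed_family_def)
  with One.prems loop_eq.refl[of c One] show ?case by blast
next
  case (Mul s t)
  obtain S1 s' where S1: "closed_family c S1" "S \<subseteq> S1" "s' \<in> S1" "loop_eq c s s'"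
    using Mul.IH(1)[of S] Mul.prems by auto
  obtain S2 t' where S2: "closed_family c S2" "S1 \<subseteq> S2" "t' \<in> S2" "loop_eq c t t'"
    using Mul.IH(2)[of S1] Mul.prems S1 by auto
  have eq: "loop_eq c (Mul s t) (Mul s' t')" using S1 S2 loop_eq.cong_mul by blast
  have "\<exists>S'. closed_family c S' \<and> S2 \<subseteq> S' \<and> (\<exists>w\<in>S'. loop_eq c (Mul s t) w)"
    by (rule closed_family_add[OF S2(1) eq]) (use S1 S2 in \<open>auto intro: closed_family_Mul\<close>)
  then show ?case using S1(2) S2(2) by (meson subset_trans)
next
  case (LDiv s t)
  obtain S1 s' where S1: "closed_family c S1" "S \<subseteq> S1" "s' \<in> S1" "loop_eq c s s'"
    using LDiv.IH(1)[of S] LDiv.prems by auto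
  obtain S2 t' where S2: "closed_family c S2" "S1 \<subseteq> S2" "t' \<in> S2" "loop_eq c t t'"
    using LDiv.IH(2)[of S1] LDiv.prems S1 by auto
  have eq: "loop_eq c (LDiv s t) (LDiv s' t')" using S1 S2 loop_eq.cong_ldiv by blast
  have quot: "loop_eq c (op_mul True s' (LDiv s' t')) t'"
    by (simp add: op_mul_def loop_eq.mul_ldiv)
  have "\<exists>S'. closed_family c S' \<and> S2 \<subseteq> S' \<and> (\<exists>w\<in>S'. loop_eq c (LDiv s t) w)"
  proof (rule closed_family_add[OF S2(1) eq])
    assume "\<And>v. v \<in> S2 \<Longrightarrow> \<not> loop_eq c (LDiv s' t') v"
    then show "closed_family c (insert (LDiv s' t') S2)"
      using S1 S2 quot by (intro closed_family_quotient[of c S2 s' t']) auto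
  qed
  then show ?case using S1(2) S2(2) by (meson subset_trans)
next
  case (RDiv t s)
  obtain S1 t' where S1: "closed_family c S1" "S \<subseteq> S1" "t' \<in> S1" "loop_eq c t t'"
    using RDiv.IH(1)[of S] RDiv.prems by auto
  obtain S2 s' where S2: "closed_family c S2" "S1 \<subseteq> S2" "s' \<in> S2" "loop_eq c s s'"
    using RDiv.IH(2)[of S1] RDiv.prems S1 by auto
  have eq: "loop_eq c (RDiv t s) (RDiv t' s')" using S1 S2 loop_eq.cong_rdiv by blast
  have quot: "loop_eq c (op_mul False s' (RDiv t' s')) t'"
    by (simp add: op_mul_def loop_eq.mul_rdiv)
  have "\<exists>S'. closed_family c S' \<and> S2 \<subseteq> S' \<and> (\<exists>w\<in>S'. loop_eq c (RDiv t s) w)"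
  proof (rule closed_family_add[OF S2(1) eq])
    assume "\<And>v. v \<in> S2 \<Longrightarrow> \<not> loop_eq c (RDiv t' s') v"
    then show "closed_family c (insert (RDiv t' s') S2)"
      using S1 S2 quot by (intro closed_family_quotient[of c S2 s' t']) auto
  qed
  then show ?case using S1(2) S2(2) by (meson subset_trans)
qed

lemma indep_inj:
  assumes S: "finite S" "indep c S" and st: "s \<in> S" "t \<in> S" and eq: "mg c s = mg c t"
  shows "s = t"
proof -
  let ?d = "\<lambda>v. of_bool (v = s) - of_bool (v = t) :: rat"
  have single: "(\<Sum>v\<in>S. of_bool (v = u) * mg c v x) = mg c u x" if "u \<in> S" for u x
  proof -
    have "(\<Sum>v\<in>S. of_bool (v = u) * mg c v x) = (\<Sum>v\<in>S. if v = u then mg c u x else 0)"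
      by (intro sum.cong) auto
    then show ?thesis using S that by simp
  qed
  have "(\<Sum>v\<in>S. ?d v * mg c v x) = 0" for x
    by (simp add: left_diff_distrib sum_subtractf single st eq)
  then have "?d s = 0" using indepD[OF S(2), of ?d s] st by blast
  then show ?thesis by (auto split: if_splits)
qed

lemma mg_eq_iff:
  assumes "gens s \<subseteq> {1..n}" "gens t \<subseteq> {1..n}"
  shows "mg c s = mg c t \<longleftrightarrow> loop_eq c s t"
proof
  assume eq: "mg c s = mg c t"
  let ?S = "insert One (Gen ` {1..n})"
  obtain S1 s' where S1: "closed_family c S1" "?S \<subseteq> S1" "s' \<in> S1" "loop_eq c s s'"
    using closed_family_extend[OF closed_family_gens[of c n], of s] assms(1) by blast
  \<comment> \<open>Extending \<open>S1\<close> rather than the initial family places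
    \<open>s'\<close> and \<open>t'\<close> in a common independent family.\<close>
  obtain S2 t' where S2: "closed_family c S2" "S1 \<subseteq> S2" "t' \<in> S2" "loop_eq c t t'"
    using closed_family_extend[OF S1(1), of t] assms(2) S1(2) by blast
  have "mg c s' = mg c t'" using eq mg_loop_eq[OF S1(4)] mg_loop_eq[OF S2(4)] by simp
  then have "s' = t'"
    using indep_inj[of S2 c s' t'] S1 S2 by (auto simp: closed_family_def)
  then show "loop_eq c s t" using S1(4) S2(4) loop_eq.sym loop_eq.trans by metis
qed (rule mg_loop_eq)

theorem theorem5p1:
  fixes n :: nat
  shows "(\<forall>s t. gens s \<subseteq> {1..n} \<longrightarrow> gens t \<subseteq> {1..n} \<longrightarrow>
            (magnus s = magnus t \<longleftrightarrow> free_loop_eq s t))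
       \<and> (\<forall>s t. gens s \<subseteq> {1..n} \<longrightarrow> gens t \<subseteq> {1..n} \<longrightarrow>
            (magnus_c s = magnus_c t \<longleftrightarrow> free_comm_loop_eq s t))"
  using mg_eq_iff[where c = False] mg_eq_iff[where c = True] by (simp add: mg_def)

end
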